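(* For each $N\ge1$ let $J_N$ be a real symmetric $N\times N$ matrix with zero diagonal, let $\beta_0>0$, and let $\{a_N\}_{N\ge1}$ be a sequence of positive reals diverging to $\infty$ such that for some $\delta\in(0,\beta_0)$ $$0<\liminf_{N\to\infty}\frac1{a_N}F_N(\beta_0-\delta)\le\limsup_{N\to\infty}\frac1{a_N}F_N(\beta_0+\delta)<\infty.$$ Then: (a) $\lim_{\varepsilon\to0}\limsup_{N\to\infty}\mathbb{P}_{\beta_0}(H_N(\sigma)<\varepsilon a_N)=0$; (b) $\lim_{K\to\infty}\limsup_{N\to\infty}\mathbb{P}_{\beta_0}(H_N(\sigma)>Ka_N)=0$.
   Context: Let $S_N=\{-1,1\}^N$ and $H_N(\tau)=\tau'J_N\tau=\sum_{i,j}J_N(i,j)\tau_i\tau_j$ for $\tau\in S_N$. For $\beta\ge0$, $\mathbb P_\beta$ is the probability measure on $S_N$ with $$\mathbb{P}_\beta(\sigma=\tau)=2^{-N}\exp\{\tfrac12\beta H_N(\tau)-F_N(\beta)\},\qquad F_N(\beta)=\log\Big\{2^{-N}\sum_{\tau\in S_N}e^{\frac12\beta H_N(\tau)}\Big\}.$$ *)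

theory Defs
  imports "HOL-Probability.Probability" "Jordan_Normal_Form.Matrix"
begin

unbundle no vec_syntax
no_notation inner (infix "\<bullet>" 70)

definition spins :: "nat \<Rightarrow> real vec set" where
  "spins N = {\<tau> \<in> carrier_vec N. \<forall>i<N. \<tau> $ i \<in> {-1, 1}}"

definition hamiltonian :: "real mat \<Rightarrow> real vec \<Rightarrow> real" where
  "hamiltonian A \<tau> = \<tau> \<bullet> (A *\<^sub>v \<tau>)"

text \<open>The size \<open>N\<close> is read off from the matrix.\<close>

definition free_energy :: "real mat \<Rightarrow> real \<Rightarrow> real" where
  "free_energy A \<beta> =
     ln ((\<Sum>\<tau>\<in>spins (dim_row A). exp (\<beta> * hamiltonian A \<tau> / 2)) / 2 ^ dim_row A)"

definition gibbs :: "real mat \<Rightarrow> real \<Rightarrow> real vec measure" where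
  "gibbs A \<beta> = point_measure (spins (dim_row A))
     (\<lambda>\<tau>. ennreal (exp (\<beta> * hamiltonian A \<tau> / 2 - free_energy A \<beta>) / 2 ^ dim_row A))"

lemma hamiltonian_eq_sum:
  assumes "A \<in> carrier_mat N N" and "\<tau> \<in> carrier_vec N"
  shows "hamiltonian A \<tau> = (\<Sum>i<N. \<Sum>j<N. A $$ (i, j) * \<tau> $ i * \<tau> $ j)"
proof -
  have "hamiltonian A \<tau> = (\<Sum>i<N. \<tau> $ i * (\<Sum>j<N. A $$ (i, j) * \<tau> $ j))"
    using assms by (auto simp: hamiltonian_def scalar_prod_def lessThan_atLeast0 intro!: sum.cong)
  then show ?thesis
    by (simp add: sum_distrib_left mult_ac)
qed

lemma bij_betw_spins:
  "bij_betw (\<lambda>f. vec N f) (PiE {..<N} (\<lambda>_. {-1, 1})) (spins N)"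
proof (rule bij_betwI[where g = "\<lambda>\<tau>. restrict (\<lambda>i. \<tau> $ i) {..<N}"])
  show "vec N \<in> (PiE {..<N} (\<lambda>_. {-1, 1})) \<rightarrow> spins N"
    by (auto simp: spins_def PiE_iff)
  show "(\<lambda>\<tau>. restrict (\<lambda>i. \<tau> $ i) {..<N}) \<in> spins N \<rightarrow> (PiE {..<N} (\<lambda>_. {-1, 1}))"
    by (auto simp: spins_def PiE_iff)
  show "restrict (\<lambda>i. vec N f $ i) {..<N} = f" if "f \<in> (PiE {..<N} (\<lambda>_. {-1, 1}))" for f :: "nat \<Rightarrow> real"
    using that by (auto simp: PiE_iff extensional_def restrict_def fun_eq_iff)
  show "vec N (restrict (\<lambda>i. \<tau> $ i) {..<N}) = \<tau>" if "\<tau> \<in> spins N" for \<tau>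
    using that by (auto simp: spins_def)
qed

lemma finite_spins: "finite (spins N)"
  using bij_betw_finite[OF bij_betw_spins[of N]] by (simp add: finite_PiE)

lemma card_spins: "card (spins N) = 2 ^ N"
  using bij_betw_same_card[OF bij_betw_spins[of N]] by (simp add: card_PiE numeral_2_eq_2)

lemma prob_space_gibbs: "prob_space (gibbs A \<beta>)"
proof
  let ?S = "spins (dim_row A)"
  let ?Z = "\<Sum>\<tau>\<in>?S. exp (\<beta> * hamiltonian A \<tau> / 2)"
  have "?S \<noteq> {}"
    using card_spins[of "dim_row A"] by force
  then have Z: "?Z > 0"
    by (intro sum_pos finite_spins) auto
  then have F: "exp (free_energy A \<beta>) = ?Z / 2 ^ dim_row A"
    by (simp add: free_energy_def)
  have "(\<Sum>\<tau>\<in>?S. exp (\<beta> * hamiltonian A \<tau> / 2 - free_energy A \<beta>) / 2 ^ dim_row A)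
      = ?Z / exp (free_energy A \<beta>) / 2 ^ dim_row A"
    by (simp only: exp_diff sum_divide_distrib)
  also have "\<dots> = 1"
    unfolding F using Z by simp
  finally show "emeasure (gibbs A \<beta>) (space (gibbs A \<beta>)) = 1"
    by (simp add: gibbs_def space_point_measure emeasure_point_measure_finite finite_spins sum_ennreal)
qed

end

theory Submission
  imports Defs
begin

text \<open>
  Both parts are exponential Markov bounds. On \<open>{H < \<epsilon> a}\<close> the Gibbs weight is at most
  \<open>exp (\<beta>\<^sub>0 \<epsilon> a / 2 - F \<beta>\<^sub>0)\<close>, and tilting by \<open>exp (\<delta> H / 2)\<close> bounds the probability of \<open>{H > K a}\<close>
  by \<open>exp (F (\<beta>\<^sub>0 + \<delta>) - F \<beta>\<^sub>0 - \<delta> K a / 2)\<close>. The lower bound on \<open>F \<beta>\<^sub>0\<close> comes from the one on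
  \<open>F (\<beta>\<^sub>0 - \<delta>)\<close>: since \<open>exp (s x) \<le> 1 + exp (t x)\<close> for \<open>0 \<le> s \<le> t\<close>, the partition functions
  satisfy \<open>Z s \<le> 1 + Z t\<close>, and the 1 is negligible because \<open>a\<close> diverges.
\<close>

lemma exp_free_energy:
  "exp (free_energy A \<beta>) =
    (\<Sum>\<tau>\<in>spins (dim_row A). exp (\<beta> * hamiltonian A \<tau> / 2)) / 2 ^ dim_row A"
proof -
  have "spins (dim_row A) \<noteq> {}"
    using card_spins[of "dim_row A"] by force
  then have "(\<Sum>\<tau>\<in>spins (dim_row A). exp (\<beta> * hamiltonian A \<tau> / 2)) > 0"
    by (intro sum_pos finite_spins) auto
  then show ?thesis
    by (simp add: free_energy_def)
qed

lemma prob_gibbs: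
  "\<P>(\<sigma> in gibbs A \<beta>. P \<sigma>) =
    (\<Sum>\<tau>\<in>{\<tau> \<in> spins (dim_row A). P \<tau>}. exp (\<beta> * hamiltonian A \<tau> / 2 - free_energy A \<beta>) / 2 ^ dim_row A)"
proof -
  have "emeasure (gibbs A \<beta>) {\<tau> \<in> spins (dim_row A). P \<tau>} =
    ennreal (\<Sum>\<tau>\<in>{\<tau> \<in> spins (dim_row A). P \<tau>}. exp (\<beta> * hamiltonian A \<tau> / 2 - free_energy A \<beta>) / 2 ^ dim_row A)"
    unfolding gibbs_def
    by (subst emeasure_point_measure_finite) (auto simp: finite_spins sum_ennreal)
  then show ?thesis
    by (simp add: gibbs_def space_point_measure measure_def sum_nonneg)
qed

text \<open>The exponential is monotone in the parameter only where the Hamiltonian is nonnegative;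
  elsewhere the smaller parameter contributes at most 1. These ones total at most
  \<open>2 ^ dim_row A\<close>, which the normalisation turns into 1.\<close>

lemma exp_free_energy_le:
  assumes "0 \<le> s" "s \<le> t"
  shows "exp (free_energy A s) \<le> 1 + exp (free_energy A t)"
proof -
  have "exp (s * x / 2) \<le> 1 + exp (t * x / 2)" for x :: real
  proof (cases "x \<le> 0")
    case True
    then have "exp (s * x / 2) \<le> 1"
      using assms by (simp add: mult_nonneg_nonpos)
    then show ?thesis
      by (simp add: add_increasing2)
  next
    case False
    then have "exp (s * x / 2) \<le> exp (t * x / 2)"
      using assms by (simp add: mult_right_mono)
    then show ?thesis
      by (intro add_increasing) simp_all
  qed
  then have "(\<Sum>\<tau>\<in>spins (dim_row A). exp (s * hamiltonian A \<tau> / 2))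
      \<le> (\<Sum>\<tau>\<in>spins (dim_row A). 1 + exp (t * hamiltonian A \<tau> / 2))"
    by (intro sum_mono)
  also have "\<dots> = 2 ^ dim_row A + (\<Sum>\<tau>\<in>spins (dim_row A). exp (t * hamiltonian A \<tau> / 2))"
    by (simp add: sum.distrib card_spins)
  finally show ?thesis
    by (simp add: exp_free_energy field_simps)
qed

lemma gibbs_hamiltonian_less:
  assumes "0 \<le> \<beta>"
  shows "\<P>(\<sigma> in gibbs A \<beta>. hamiltonian A \<sigma> < x) \<le> exp (\<beta> * x / 2 - free_energy A \<beta>)"
proof -
  let ?B = "{\<tau> \<in> spins (dim_row A). hamiltonian A \<tau> < x}"
  have "\<P>(\<sigma> in gibbs A \<beta>. hamiltonian A \<sigma> < x)
      \<le> (\<Sum>\<tau>\<in>?B. exp (\<beta> * x / 2 - free_energy A \<beta>) / 2 ^ dim_row A)"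
    unfolding prob_gibbs using assms
    by (intro sum_mono divide_right_mono) (auto intro!: mult_left_mono)
  \<comment> \<open>The summand is now constant, so summing over all spins cancels the factor
    \<open>2 ^ dim_row A\<close>.\<close>
  also have "\<dots> \<le> (\<Sum>\<tau>\<in>spins (dim_row A). exp (\<beta> * x / 2 - free_energy A \<beta>) / 2 ^ dim_row A)"
    by (intro sum_mono2 finite_spins) auto
  also have "\<dots> = exp (\<beta> * x / 2 - free_energy A \<beta>)"
    by (simp add: card_spins)
  finally show ?thesis .
qed

lemma gibbs_hamiltonian_greater:
  assumes "0 \<le> \<delta>"
  shows "\<P>(\<sigma> in gibbs A \<beta>. x < hamiltonian A \<sigma>)
    \<le> exp (free_energy A (\<beta> + \<delta>) - free_energy A \<beta> - \<delta> * x / 2)"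
proof -
  let ?B = "{\<tau> \<in> spins (dim_row A). x < hamiltonian A \<tau>}"
  let ?c = "exp (- free_energy A \<beta> - \<delta> * x / 2)"
  \<comment> \<open>The right side exceeds the left by \<open>\<delta> * (h - x) / 2\<close>. Its
    terms are grouped so that \<open>?c\<close> is free of the spin and the rest sums to the
    partition function at \<open>\<beta> + \<delta>\<close>.\<close>
  have "\<beta> * h / 2 - F \<le> (\<beta> + \<delta>) * h / 2 + (- F - \<delta> * x / 2)" if "x < h" for h F :: real
    using mult_left_mono[OF less_imp_le[OF that] assms] by (simp add: algebra_simps)
  then have "\<P>(\<sigma> in gibbs A \<beta>. x < hamiltonian A \<sigma>)
      \<le> (\<Sum>\<tau>\<in>?B. exp ((\<beta> + \<delta>) * hamiltonian A \<tau> / 2) * ?c / 2 ^ dim_row A)"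
    unfolding prob_gibbs exp_add[symmetric]
    by (intro sum_mono divide_right_mono) auto
  also have "\<dots> \<le> (\<Sum>\<tau>\<in>spins (dim_row A). exp ((\<beta> + \<delta>) * hamiltonian A \<tau> / 2) * ?c / 2 ^ dim_row A)"
    by (intro sum_mono2 finite_spins) auto
  also have "\<dots> = exp (free_energy A (\<beta> + \<delta>)) * ?c"
    by (simp only: exp_free_energy sum_divide_distrib sum_distrib_right times_divide_eq_left)
  also have "\<dots> = exp (free_energy A (\<beta> + \<delta>) - free_energy A \<beta> - \<delta> * x / 2)"
    by (simp add: exp_add[symmetric])
  finally show ?thesis .
qed

text \<open>Reduces each tail estimate to finding, for a fixed threshold, some negative rate at the
  scale of \<open>a\<close>.\<close>

lemma limsup_eq_0_of_exp_bound:
  fixes p a :: "nat \<Rightarrow> real"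
  assumes "filterlim a at_top sequentially" and "r < 0"
    and "\<And>N. 0 \<le> p N" and "eventually (\<lambda>N. p N \<le> exp (r * a N)) sequentially"
  shows "limsup (\<lambda>N. ereal (p N)) = 0"
proof -
  have "filterlim (\<lambda>N. r * a N) at_bot sequentially"
    using filterlim_tendsto_neg_mult_at_bot[OF tendsto_const assms(2,1)] .
  then have "(\<lambda>N. exp (r * a N)) \<longlonglongrightarrow> 0"
    by (rule filterlim_compose[OF exp_at_bot])
  then have "p \<longlonglongrightarrow> 0"
    using assms(3,4) by (intro real_tendsto_sandwich[OF _ _ tendsto_const, of _ p]) auto
  then have "(\<lambda>N. ereal (p N)) \<longlonglongrightarrow> ereal 0"
    by simp
  then show ?thesis
    by (simp add: lim_imp_Limsup zero_ereal_def)
qed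

theorem lemma5p1:
  fixes J :: "nat \<Rightarrow> real mat" and a :: "nat \<Rightarrow> real" and \<beta>\<^sub>0 \<delta> :: real
  assumes J_carrier: "\<And>N. N \<ge> 1 \<Longrightarrow> J N \<in> carrier_mat N N"
    and J_symmetric: "\<And>N. N \<ge> 1 \<Longrightarrow> transpose_mat (J N) = J N"
    and J_diag: "\<And>N i. N \<ge> 1 \<Longrightarrow> i < N \<Longrightarrow> J N $$ (i, i) = 0"
    and \<beta>\<^sub>0_pos: "\<beta>\<^sub>0 > 0"
    and a_pos: "\<And>N. N \<ge> 1 \<Longrightarrow> a N > 0"
    and a_infinity: "filterlim a at_top sequentially"
    and \<delta>: "\<delta> \<in> {0<..<\<beta>\<^sub>0}"
    and lower: "0 < liminf (\<lambda>N. ereal (free_energy (J N) (\<beta>\<^sub>0 - \<delta>) / a N))"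
    and middle: "liminf (\<lambda>N. ereal (free_energy (J N) (\<beta>\<^sub>0 - \<delta>) / a N))
      \<le> limsup (\<lambda>N. ereal (free_energy (J N) (\<beta>\<^sub>0 + \<delta>) / a N))"
    and upper: "limsup (\<lambda>N. ereal (free_energy (J N) (\<beta>\<^sub>0 + \<delta>) / a N)) < \<infinity>"
  shows "((\<lambda>\<epsilon>. limsup (\<lambda>N. ereal (\<P>(\<sigma> in gibbs (J N) \<beta>\<^sub>0. hamiltonian (J N) \<sigma> < \<epsilon> * a N))))
            \<longlongrightarrow> 0) (at (0::real))
       \<and> ((\<lambda>K. limsup (\<lambda>N. ereal (\<P>(\<sigma> in gibbs (J N) \<beta>\<^sub>0. hamiltonian (J N) \<sigma> > K * a N))))
            \<longlongrightarrow> 0) (at_top :: real filter)"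
proof -
  let ?F = "\<lambda>\<beta> N. free_energy (J N) \<beta>"
  \<comment> \<open>Real constants strictly inside the extended-real bounds: the liminf may be
    infinite, and strictness yields inequalities valid for all large \<open>N\<close>.\<close>
  from lower obtain c where c: "0 < c"
      "ereal c < liminf (\<lambda>N. ereal (?F (\<beta>\<^sub>0 - \<delta>) N / a N))"
    using ereal_dense2[of 0] by (auto simp: zero_ereal_def)
  from upper obtain C where C: "limsup (\<lambda>N. ereal (?F (\<beta>\<^sub>0 + \<delta>) N / a N)) < ereal C"
    using ereal_dense2 by blast
  \<comment> \<open>Restricting to \<open>N \<ge> 1\<close> makes \<open>a N\<close> positive, so
    the division can be cleared.\<close>
  have lower': "eventually (\<lambda>N. c * a N \<le> ?F (\<beta>\<^sub>0 - \<delta>) N) sequentially"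
    using less_LiminfD[OF c(2)] eventually_ge_at_top[of 1]
    by eventually_elim (use a_pos in \<open>auto simp: field_simps less_imp_le\<close>)
  have upper': "eventually (\<lambda>N. ?F (\<beta>\<^sub>0 + \<delta>) N \<le> C * a N) sequentially"
    using Limsup_lessD[OF C] eventually_ge_at_top[of 1]
    by eventually_elim (use a_pos in \<open>auto simp: field_simps less_imp_le\<close>)
  \<comment> \<open>Halving the rate pays for the additive 1: once \<open>a N > 2 / c\<close>,
    \<open>?y\<close> is at least 2, so its square is at least \<open>?y + 1\<close>.\<close>
  have F: "eventually (\<lambda>N. c * a N / 2 \<le> ?F \<beta>\<^sub>0 N) sequentially"
    using lower' filterlim_at_top_dense[THEN iffD1, rule_format, OF a_infinity, of "2 / c"]
  proof eventually_elim
    case (elim N)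
    let ?y = "exp (c * a N / 2)"
    have "2 \<le> ?y"
      using elim c exp_ge_add_one_self[of "c * a N / 2"] by (simp add: field_simps)
    then have "?y + 1 \<le> ?y * ?y"
      using mult_right_mono[of 2 ?y ?y] by linarith
    also have "\<dots> = exp (c * a N)"
      by (simp flip: exp_add)
    also have "\<dots> \<le> exp (?F (\<beta>\<^sub>0 - \<delta>) N)"
      using elim by simp
    also have "\<dots> \<le> 1 + exp (?F \<beta>\<^sub>0 N)"
      using \<delta> by (intro exp_free_energy_le) auto
    finally show ?case
      by simp
  qed

  \<comment> \<open>For such \<open>\<epsilon>\<close> the energy term is at most
    \<open>c * a N / 4\<close>, half of the lower bound on the free energy, leaving rate
    \<open>- c / 4\<close>. The limsup is then exactly 0 near the origin, on both sides.\<close>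
  have "eventually (\<lambda>\<epsilon>. \<epsilon> < c / (2 * \<beta>\<^sub>0)) (at (0::real))"
    using c \<beta>\<^sub>0_pos by (intro order_tendstoD[OF tendsto_ident_at]) auto
  then have a: "eventually (\<lambda>\<epsilon>. limsup (\<lambda>N. ereal (\<P>(\<sigma> in gibbs (J N) \<beta>\<^sub>0. hamiltonian (J N) \<sigma> < \<epsilon> * a N))) = 0) (at (0::real))"
  proof eventually_elim
    case (elim \<epsilon>)
    show ?case
    proof (rule limsup_eq_0_of_exp_bound[OF a_infinity, of "- c / 4"])
      show "eventually (\<lambda>N. \<P>(\<sigma> in gibbs (J N) \<beta>\<^sub>0. hamiltonian (J N) \<sigma> < \<epsilon> * a N) \<le> exp (- c / 4 * a N)) sequentially"
        using F eventually_ge_at_top[of 1]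
      proof eventually_elim
        case N: (elim N)
        have "\<beta>\<^sub>0 * \<epsilon> \<le> c / 2"
          using elim \<beta>\<^sub>0_pos by (simp add: field_simps)
        from mult_right_mono[OF this less_imp_le[OF a_pos[OF N(2)]]]
        have "\<beta>\<^sub>0 * (\<epsilon> * a N) / 2 - ?F \<beta>\<^sub>0 N \<le> - c / 4 * a N"
          using N(1) by (simp add: algebra_simps)
        then show ?case
          using gibbs_hamiltonian_less[of \<beta>\<^sub>0 "J N" "\<epsilon> * a N"] \<beta>\<^sub>0_pos
          by (meson exp_le_cancel_iff less_imp_le order_trans)
      qed
    qed (use c in auto)
  qed

  \<comment> \<open>From \<open>K = 2 * C / \<delta>\<close> on, the tilt term
    \<open>\<delta> * K * a N / 2\<close> cancels the bound \<open>C * a N\<close>, and the free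
    energy at \<open>\<beta>\<^sub>0\<close> supplies the rate \<open>- c / 2\<close>.\<close>
  have b: "eventually (\<lambda>K. limsup (\<lambda>N. ereal (\<P>(\<sigma> in gibbs (J N) \<beta>\<^sub>0. hamiltonian (J N) \<sigma> > K * a N))) = 0) at_top"
    using eventually_ge_at_top[of "2 * C / \<delta>"]
  proof eventually_elim
    case (elim K)
    show ?case
    proof (rule limsup_eq_0_of_exp_bound[OF a_infinity, of "- c / 2"])
      show "eventually (\<lambda>N. \<P>(\<sigma> in gibbs (J N) \<beta>\<^sub>0. hamiltonian (J N) \<sigma> > K * a N) \<le> exp (- c / 2 * a N)) sequentially"
        using F upper' eventually_ge_at_top[of 1]
      proof eventually_elim
        case N: (elim N)
        have "C \<le> \<delta> * K / 2"
          using elim \<delta> by (simp add: field_simps)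
        from mult_right_mono[OF this less_imp_le[OF a_pos[OF N(3)]]]
        have "?F (\<beta>\<^sub>0 + \<delta>) N - ?F \<beta>\<^sub>0 N - \<delta> * (K * a N) / 2 \<le> - c / 2 * a N"
          using N(1,2) by (simp add: algebra_simps)
        then show ?case
          using gibbs_hamiltonian_greater[of \<delta> "J N" \<beta>\<^sub>0 "K * a N"] \<delta>
          by (meson exp_le_cancel_iff greaterThanLessThan_iff less_imp_le order_trans)
      qed
    qed (use c in auto)
  qed

  show ?thesis
    using tendsto_eventually[OF a] tendsto_eventually[OF b] by blast
qed

end
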